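(* Let $g:\mathbb{R}^d\to\mathbb{R}^n$ with $\mathcal{Z}=\operatorname{cl}\{g(\theta):\theta\in\mathbb{R}^d\}=\mathbb{R}^n$. Let $F:\mathbb{R}^n\to\mathbb{R}^n$ be $L$-Lipschitz and $\mu$-strongly monotone ($\mu>0$), and let $z_\ast$ be the solution of $\langle F(z_\ast),z-z_\ast\rangle\ge0$ for all $z\in\mathcal{Z}$. Let $\xi$ be a random variable and $F_\xi$ a random operator with $\mathbb{E}_\xi[F_\xi(z)]=F(z)$ for all $z$, let $\sigma^2=\mathbb{E}_\xi[\|F_\xi(z_\ast)\|^2]$, and assume $$\mathbb{E}_\xi[\|F_\xi(z)\|^2]\le 2L\langle F(z),z-z_\ast\rangle+2\sigma^2\quad\text{for all } z\in\mathcal{Z}.$$ Let $\alpha\in[0,1)$. If $F_\xi$ is $L$-Lipschitz and $0<\eta\le\frac{1}{2(1+c)L}$ where $c\ge2(1+\alpha^2)$, then any trajectory $\{\theta_t\}_{t\in\mathbb{N}}$ satisfying the $\alpha$-expected descent condition guarantees, with $z_t=g(\theta_t)$, for every $t$, $$\mathbb{E}\left[\tfrac12\|z_{t+1}-z_\ast\|^2\right]\le\mathbb{E}\left[\tfrac12\|z_t-z_\ast\|^2\right]\left(1-\eta\mu+\alpha^2\right)+\eta^2(1+c)\sigma^2 .$$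
   Context: $\|\cdot\|$, $\langle\cdot,\cdot\rangle$ are Euclidean; $\operatorname{cl}$ denotes closure. $L$-Lipschitz: $\|F(x)-F(y)\|\le L\|x-y\|$; $\mu$-strongly monotone: $\langle F(x)-F(y),x-y\rangle\ge\mu\|x-y\|^2$, for all $x,y$. Sampling: $\xi_1,\xi_2,\dots$ are i.i.d. copies of $\xi$, with $\xi_t$ independent of the history up to and including $\theta_t$. $\alpha$-expected descent condition: with step size $\eta>0$, let $\tilde\ell_t(\theta)=\frac12\|g(\theta)-(g(\theta_t)-\eta F_{\xi_t}(z_t))\|^2$ and $\tilde\ell_t^\ast=\inf_{\theta\in\mathbb{R}^d}\tilde\ell_t(\theta)$. The random trajectory $\{\theta_t\}$ satisfies the condition if for each $t$, given $F_{\xi_t}(z_t)$ (i.e. conditionally on the history up to $\theta_t$ and on $\xi_t$), $\theta_{t+1}$ is generated, possibly with additional randomness, such that $\mathbb{E}[\tilde\ell_t(\theta_{t+1})-\tilde\ell_t^\ast]\le\alpha^2(\tilde\ell_t(\theta_t)-\tilde\ell_t^\ast)$, where the expectation is over this additional randomness in $\theta_{t+1}$. *)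

theory Defs
  imports "HOL-Probability.Probability"
begin

definition strongly_monotone :: "real \<Rightarrow> ('a::real_inner \<Rightarrow> 'a) \<Rightarrow> bool" where
  "strongly_monotone \<mu> F \<longleftrightarrow> (\<forall>x y. (F x - F y) \<bullet> (x - y) \<ge> \<mu> * (norm (x - y))\<^sup>2)"

definition VI_solution :: "('a::real_inner \<Rightarrow> 'a) \<Rightarrow> 'a set \<Rightarrow> 'a \<Rightarrow> bool" where
  "VI_solution F Z zs \<longleftrightarrow> zs \<in> Z \<and> (\<forall>z\<in>Z. F zs \<bullet> (z - zs) \<ge> 0)"

text \<open>The \<open>\<sigma>\<close>-algebra generated by the parameters \<open>\<theta> 0, \<dots>, \<theta> t\<close> and the samples
  \<open>\<xi> s\<close> with \<open>s < k\<close>.  The history up to and including \<open>\<theta> t\<close> is the case \<open>k = t\<close>;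
  \<open>k = Suc t\<close> adds the sample \<open>\<xi> t\<close> used in the step from \<open>\<theta> t\<close> to \<open>\<theta> (Suc t)\<close>.\<close>

definition history ::
    "'w measure \<Rightarrow> 'x measure \<Rightarrow> (nat \<Rightarrow> 'w \<Rightarrow> 'p::topological_space) \<Rightarrow> (nat \<Rightarrow> 'w \<Rightarrow> 'x) \<Rightarrow>
      nat \<Rightarrow> nat \<Rightarrow> 'w measure" where
  "history M S \<theta> \<xi> t k =
     sigma (space M)
       ({\<theta> s -` A \<inter> space M | s A. s \<le> t \<and> A \<in> sets borel} \<union>
        {\<xi> s -` B \<inter> space M | s B. s < k \<and> B \<in> sets S})"

definition surrogate_loss ::
    "('p \<Rightarrow> 'a::real_normed_vector) \<Rightarrow> real \<Rightarrow> ('a \<Rightarrow> 'a) \<Rightarrow> 'p \<Rightarrow> 'p \<Rightarrow> real" where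
  "surrogate_loss g \<eta> G \<theta>\<^sub>t \<theta> = 1/2 * (norm (g \<theta> - (g \<theta>\<^sub>t - \<eta> *\<^sub>R G (g \<theta>\<^sub>t))))\<^sup>2"

definition excess_loss ::
    "('p \<Rightarrow> 'a::real_normed_vector) \<Rightarrow> real \<Rightarrow> ('a \<Rightarrow> 'a) \<Rightarrow> 'p \<Rightarrow> 'p \<Rightarrow> real" where
  "excess_loss g \<eta> G \<theta>\<^sub>t \<theta> =
     surrogate_loss g \<eta> G \<theta>\<^sub>t \<theta> - (INF \<theta>'. surrogate_loss g \<eta> G \<theta>\<^sub>t \<theta>')"

text \<open>The excess loss is nonnegative but need not be integrable, so its conditional expectation is
  taken in \<open>[0, \<infinity>]\<close>.  The expectation over the additional randomness in \<open>\<theta> (Suc t)\<close> is the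
  conditional expectation given the history up to \<open>\<theta> t\<close> and the sample \<open>\<xi> t\<close>.
  Pitfall: \<^const>\<open>nn_cond_exp\<close> is \<open>0\<close> by convention unless its argument is measurable and the
  conditioning \<open>\<sigma>\<close>-algebra is contained in that of \<open>M\<close>, so the condition is meaningful for
  measurable \<open>g\<close>, \<open>\<theta> t\<close>, \<open>\<xi> t\<close> and jointly measurable \<open>Fs\<close>; when the range of \<open>g\<close> is dense the
  infimum is \<open>0\<close>.\<close>

definition expected_descent ::
    "real \<Rightarrow> real \<Rightarrow> 'w measure \<Rightarrow> 'x measure \<Rightarrow> ('p::topological_space \<Rightarrow> 'a::real_normed_vector) \<Rightarrow>
      ('x \<Rightarrow> 'a \<Rightarrow> 'a) \<Rightarrow> (nat \<Rightarrow> 'w \<Rightarrow> 'p) \<Rightarrow> (nat \<Rightarrow> 'w \<Rightarrow> 'x) \<Rightarrow> bool" where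
  "expected_descent \<alpha> \<eta> M S g Fs \<theta> \<xi> \<longleftrightarrow>
     (\<forall>t. AE \<omega> in M.
        nn_cond_exp M (history M S \<theta> \<xi> t (Suc t))
          (\<lambda>\<omega>'. ennreal (excess_loss g \<eta> (Fs (\<xi> t \<omega>')) (\<theta> t \<omega>') (\<theta> (Suc t) \<omega>'))) \<omega>
        \<le> ennreal (\<alpha>\<^sup>2 * excess_loss g \<eta> (Fs (\<xi> t \<omega>)) (\<theta> t \<omega>) (\<theta> t \<omega>)))"

end

theory Submission imports Defs begin

text \<open>Because the range of \<open>g\<close> is dense, \<open>F z\<^sub>* = 0\<close> and the infimum of the surrogate loss is \<open>0\<close>.
  Let \<open>y = z\<^sub>t - \<eta> G(z\<^sub>t)\<close> be the target of the step, where \<open>G\<close> is the sampled operator, and let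
  \<open>e = z\<^sub>t\<^sub>+\<^sub>1 - y\<close>. The descent condition says that the conditional expectation of \<open>\<parallel>e\<parallel>\<^sup>2\<close> is at most
  \<open>\<alpha>\<^sup>2 \<eta>\<^sup>2 \<parallel>G(z\<^sub>t)\<parallel>\<^sup>2\<close>. Young's inequality with weight \<open>\<alpha>\<^sup>2\<close> gives
  \<open>\<parallel>y - z\<^sub>* + e\<parallel>\<^sup>2 \<le> (1 + \<alpha>\<^sup>2) \<parallel>y - z\<^sub>*\<parallel>\<^sup>2 + (1 + 1/\<alpha>\<^sup>2) \<parallel>e\<parallel>\<^sup>2\<close>, so in expectation the distance to \<open>z\<^sub>*\<close> is at
  most \<open>1 + \<alpha>\<^sup>2\<close> times \<open>\<parallel>y - z\<^sub>*\<parallel>\<^sup>2 + \<eta>\<^sup>2 \<parallel>G(z\<^sub>t)\<parallel>\<^sup>2\<close>. The sample is independent of \<open>z\<^sub>t\<close>, so this can be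
  averaged over the sample for fixed \<open>z\<^sub>t\<close>; expanding the square and inserting the second moment bound
  and strong monotonicity gives the claim.\<close>

text \<open>The target \<open>y\<close> need not lie in the range of \<open>g\<close>, but density
  gives values of \<open>g\<close> within \<open>sqrt (2 * \<epsilon>)\<close> of it, where the loss
  is at most \<epsilon>. So the infimum is 0, attained or not.\<close>

lemma excess_loss_eq_surrogate_loss:
  assumes "closure (range g) = UNIV"
  shows "excess_loss g \<eta> G p q = surrogate_loss g \<eta> G p q"
proof -
  define y where "y = g p - \<eta> *\<^sub>R G (g p)"
  define f where "f = surrogate_loss g \<eta> G p"
  have f: "f q = 1/2 * (norm (g q - y))\<^sup>2" for q
    by (simp add: f_def surrogate_loss_def y_def)
  have bdd: "bdd_below (range f)"
    by (rule bdd_belowI[of _ 0]) (auto simp: f)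
  have "(INF q. f q) \<le> 0"
  proof (rule field_le_epsilon)
    fix \<epsilon> :: real assume \<epsilon>: "\<epsilon> > 0"
    have "y \<in> closure (range g)" using assms by simp
    then obtain q where q: "dist (g q) y < sqrt (2 * \<epsilon>)"
      unfolding closure_approachable using \<epsilon> by (metis rangeE mult_pos_pos real_sqrt_gt_zero zero_less_numeral)
    have "(INF q. f q) \<le> f q" by (rule cINF_lower[OF bdd]) simp
    also have "(norm (g q - y))\<^sup>2 \<le> (sqrt (2 * \<epsilon>))\<^sup>2"
      by (rule power_mono) (use q in \<open>auto simp: dist_norm\<close>)
    then have "f q \<le> 0 + \<epsilon>" using \<epsilon> by (simp add: f)
    finally show "(INF q. f q) \<le> 0 + \<epsilon>" .
  qed
  moreover have "0 \<le> (INF q. f q)" by (rule cINF_greatest) (auto simp: f)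
  ultimately show ?thesis by (simp add: excess_loss_def f_def)
qed

text \<open>Every point is admissible, so the inequality may be tested at
  \<open>zs - F zs\<close>.\<close>

lemma VI_solution_UNIV_zero:
  assumes "VI_solution F UNIV zs"
  shows "F zs = 0"
proof -
  have "F zs \<bullet> ((zs - F zs) - zs) \<ge> 0"
    using assms unfolding VI_solution_def by blast
  then have "F zs \<bullet> F zs \<le> 0" by simp
  then show ?thesis using inner_ge_zero[of "F zs"] by (metis antisym inner_eq_zero_iff)
qed

text \<open>Young's inequality: expanding the square of \<open>s *\<^sub>R u - v\<close> and
  dividing by \<open>s\<close> bounds the cross term.\<close>

lemma norm_add_power2_le_weighted:
  fixes u v :: "'a::real_inner"
  assumes "s > 0"
  shows "(norm (u + v))\<^sup>2 \<le> (1 + s) * (norm u)\<^sup>2 + (1 + 1 / s) * (norm v)\<^sup>2"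
proof -
  have "0 \<le> (norm (s *\<^sub>R u - v))\<^sup>2 / s" using assms by simp
  also have "\<dots> = s * (norm u)\<^sup>2 - 2 * (u \<bullet> v) + (norm v)\<^sup>2 / s"
    using assms unfolding power2_norm_eq_inner
    by (simp add: inner_diff inner_commute field_simps power2_eq_square)
  finally show ?thesis
    unfolding power2_norm_eq_inner by (simp add: inner_add inner_commute algebra_simps)
qed

text \<open>The library's \<^const>\<open>prob_space.indep_var\<close> forces both random variables to take values in the same
  type, which does not cover \<open>z\<^sub>t\<close> and \<open>\<xi>\<^sub>t\<close>.\<close>

lemma (in prob_space) nn_integral_indep_set:
  assumes X[measurable]: "random_variable S X" and Y[measurable]: "random_variable T Y"
    and indep: "indep_set {X -` A \<inter> space M | A. A \<in> sets S} {Y -` B \<inter> space M | B. B \<in> sets T}"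
    and [measurable]: "h \<in> borel_measurable (S \<Otimes>\<^sub>M T)"
  shows "(\<integral>\<^sup>+\<omega>. h (X \<omega>, Y \<omega>) \<partial>M) = (\<integral>\<^sup>+\<omega>. (\<integral>\<^sup>+y. h (X \<omega>, y) \<partial>distr M T Y) \<partial>M)"
proof -
  interpret X: prob_space "distr M S X" by (rule prob_space_distr) simp
  interpret Y: prob_space "distr M T Y" by (rule prob_space_distr) simp
  \<comment> \<open>Independence in terms of laws: the joint law is the product of the marginals, by
    comparison on rectangles. Tonelli then applies.\<close>
  have pair: "distr M S X \<Otimes>\<^sub>M distr M T Y = distr M (S \<Otimes>\<^sub>M T) (\<lambda>x. (X x, Y x))"
  proof (rule pair_measure_eqI)
    fix A B assume "A \<in> sets (distr M S X)" "B \<in> sets (distr M T Y)"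
    then have A[measurable]: "A \<in> sets S" and B[measurable]: "B \<in> sets T" by simp_all
    have "prob ((X -` A \<inter> space M) \<inter> (Y -` B \<inter> space M))
        = prob (X -` A \<inter> space M) * prob (Y -` B \<inter> space M)"
      using A B by (intro indep_setD[OF indep]) auto
    moreover have "(\<lambda>x. (X x, Y x)) -` (A \<times> B) \<inter> space M = (X -` A \<inter> space M) \<inter> (Y -` B \<inter> space M)"
      by auto
    ultimately show "emeasure (distr M S X) A * emeasure (distr M T Y) B
        = emeasure (distr M (S \<Otimes>\<^sub>M T) (\<lambda>x. (X x, Y x))) (A \<times> B)"
      by (simp add: emeasure_distr emeasure_eq_measure ennreal_mult)
  qed (simp_all add: X.sigma_finite_measure_axioms Y.sigma_finite_measure_axioms cong: sets_pair_measure_cong)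
  have "(\<integral>\<^sup>+\<omega>. h (X \<omega>, Y \<omega>) \<partial>M) = integral\<^sup>N (distr M S X \<Otimes>\<^sub>M distr M T Y) h"
    unfolding pair by (simp add: nn_integral_distr)
  also have "\<dots> = (\<integral>\<^sup>+x. (\<integral>\<^sup>+y. h (x, y) \<partial>distr M T Y) \<partial>distr M S X)"
    by (rule Y.nn_integral_fst[symmetric]) simp
  also have "\<dots> = (\<integral>\<^sup>+\<omega>. (\<integral>\<^sup>+y. h (X \<omega>, y) \<partial>distr M T Y) \<partial>M)"
    by (subst nn_integral_distr) auto
  finally show ?thesis .
qed

section \<open>The history and its conditional expectation\<close>

lemma sets_history:
  "sets (history M S \<theta> \<xi>s t k) = sigma_sets (space M)
     ({\<theta> s -` A \<inter> space M | s A. s \<le> t \<and> A \<in> sets borel} \<union>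
      {\<xi>s s -` B \<inter> space M | s B. s < k \<and> B \<in> sets S})"
  unfolding history_def by (rule sets_measure_of) auto

lemma space_history: "space (history M S \<theta> \<xi>s t k) = space M"
  by (simp add: history_def space_measure_of_conv)

lemma subalgebra_history:
  assumes "\<And>t. \<theta> t \<in> borel_measurable M" and "\<And>t. \<xi>s t \<in> measurable M S"
  shows "subalgebra M (history M S \<theta> \<xi>s t k)"
  unfolding subalgebra_def space_history sets_history using assms
  by (intro conjI sets.sigma_sets_subset) (auto intro: measurable_sets)

lemma measurable_history:
  assumes "s \<le> t"
  shows "\<theta> s \<in> borel_measurable (history M S \<theta> \<xi>s t k)"
proof (rule measurableI)
  fix A :: "'b set" assume "A \<in> sets borel"
  then show "\<theta> s -` A \<inter> space (history M S \<theta> \<xi>s t k) \<in> sets (history M S \<theta> \<xi>s t k)"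
    using assms unfolding sets_history space_history by (intro sigma_sets.Basic) blast
qed simp

text \<open>Tower property in [0, \<infinity>], from the defining identity tested against the
  constant 1; no integrability of \<open>f\<close> is required.\<close>

lemma (in sigma_finite_subalgebra) nn_integral_nn_cond_exp:
  assumes "f \<in> borel_measurable M"
  shows "(\<integral>\<^sup>+x. nn_cond_exp M F f x \<partial>M) = (\<integral>\<^sup>+x. f x \<partial>M)"
  using nn_cond_exp_intg[of "\<lambda>_. 1" f] assms by simp

text \<open>One step with the iterate frozen: \<open>d\<close> stands for its offset from the
  solution and \<open>G\<close> for the sampled operator there. After expansion only the mean inner
  product \<open>m\<close> and the second moment \<open>q\<close> remain, and \<open>q\<close> is
  bounded through \<open>m\<close>.\<close>

lemma expected_step_bound:
  fixes G :: "'p \<Rightarrow> 'a::euclidean_space" and L \<mu> \<sigma> \<alpha> \<eta> c :: real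
  assumes "prob_space P" and G: "integrable P G" "integrable P (\<lambda>p. (norm (G p))\<^sup>2)"
    and moment: "prob_space.expectation P (\<lambda>p. (norm (G p))\<^sup>2)
        \<le> 2 * L * (prob_space.expectation P G \<bullet> d) + 2 * \<sigma>\<^sup>2"
    and mono: "prob_space.expectation P G \<bullet> d \<ge> \<mu> * (norm d)\<^sup>2"
    and "L > 0" "\<mu> > 0" "0 < \<eta>" and \<eta>: "\<eta> \<le> 1 / (2 * (1 + c) * L)" and c: "c \<ge> 2 * (1 + \<alpha>\<^sup>2)"
  shows "(\<integral>\<^sup>+p. ennreal ((1 + \<alpha>\<^sup>2) / 2 * ((norm (d - \<eta> *\<^sub>R G p))\<^sup>2 + \<eta>\<^sup>2 * (norm (G p))\<^sup>2)) \<partial>P)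
    \<le> ennreal (1/2 * (norm d)\<^sup>2 * (1 - \<eta> * \<mu> + \<alpha>\<^sup>2) + \<eta>\<^sup>2 * (1 + c) * \<sigma>\<^sup>2)"
proof -
  interpret prob_space P by fact
  define m q where "m = expectation G \<bullet> d" and "q = expectation (\<lambda>p. (norm (G p))\<^sup>2)"
  let ?f = "\<lambda>p. (1 + \<alpha>\<^sup>2) / 2 * ((norm (d - \<eta> *\<^sub>R G p))\<^sup>2 + \<eta>\<^sup>2 * (norm (G p))\<^sup>2)"
  let ?h = "\<lambda>p. (1 + \<alpha>\<^sup>2) / 2 * ((norm d)\<^sup>2 - 2 * \<eta> * (G p \<bullet> d) + 2 * \<eta>\<^sup>2 * (norm (G p))\<^sup>2)"
  have eq: "?f = ?h"
    unfolding power2_norm_eq_inner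
    by (rule ext) (simp add: inner_diff inner_commute algebra_simps power2_eq_square)
  have int: "integrable P ?f" unfolding eq using G by simp
  have exp: "expectation ?h = (1 + \<alpha>\<^sup>2) / 2 * ((norm d)\<^sup>2 - 2 * \<eta> * m + 2 * \<eta>\<^sup>2 * q)"
    using G by (simp add: m_def q_def prob_space)
  have m: "m \<ge> \<mu> * (norm d)\<^sup>2" "q \<le> 2 * L * m + 2 * \<sigma>\<^sup>2"
    using mono moment by (simp_all add: m_def q_def)
  have "\<mu> * (norm d)\<^sup>2 \<ge> 0" using \<open>\<mu> > 0\<close> by simp
  then have m0: "m \<ge> 0" using m by linarith
  \<comment> \<open>This gives 2(1 + c) \<ge> 6, hence \<eta> L \<le> 1/6, so the second moment
    cancels at most a third of the descent term.\<close>
  have "c \<ge> 2" by (rule order_trans[OF _ c]) simp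
  then have "2 * (1 + c) * L > 0" using \<open>L > 0\<close> by simp
  then have "\<eta> * L * (2 * (1 + c)) \<le> 1"
    using \<eta> by (simp only: pos_le_divide_eq mult_ac)
  moreover have "\<eta> * L * 6 \<le> \<eta> * L * (2 * (1 + c))"
    using \<open>c \<ge> 2\<close> \<open>L > 0\<close> \<open>0 < \<eta>\<close> by (intro mult_left_mono) auto
  ultimately have \<eta>L: "\<eta> * L \<le> 1/6" by linarith
  have "expectation ?h \<le> (1 + \<alpha>\<^sup>2) / 2 * ((norm d)\<^sup>2 - 2 * \<eta> * m + 2 * \<eta>\<^sup>2 * (2 * L * m + 2 * \<sigma>\<^sup>2))"
    unfolding exp by (intro mult_left_mono add_left_mono m) auto
  also have "\<dots> = (1 + \<alpha>\<^sup>2) / 2 * (norm d)\<^sup>2 - (1 + \<alpha>\<^sup>2) * (1 - 2 * (\<eta> * L)) * (\<eta> * m)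
      + 2 * (1 + \<alpha>\<^sup>2) * (\<eta>\<^sup>2 * \<sigma>\<^sup>2)"
    by (simp add: field_simps power2_eq_square)
  \<comment> \<open>The factor in front of \<open>\<eta> * m\<close> is at least 1/2, and strong
    monotonicity bounds \<open>m\<close> from below; this is where \<eta> \<mu> arises.\<close>
  also have "\<dots> \<le> (1 + \<alpha>\<^sup>2) / 2 * (norm d)\<^sup>2 - 1/2 * (\<eta> * (\<mu> * (norm d)\<^sup>2)) + (1 + c) * (\<eta>\<^sup>2 * \<sigma>\<^sup>2)"
  proof (intro add_mono diff_mono)
    have "1 * (1/2) \<le> (1 + \<alpha>\<^sup>2) * (1 - 2 * (\<eta> * L))"
      by (intro mult_mono) (use \<eta>L in auto)
    then show "1/2 * (\<eta> * (\<mu> * (norm d)\<^sup>2)) \<le> (1 + \<alpha>\<^sup>2) * (1 - 2 * (\<eta> * L)) * (\<eta> * m)"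
      using m m0 \<open>0 < \<eta>\<close> \<open>\<mu> > 0\<close> by (intro mult_mono) auto
    show "2 * (1 + \<alpha>\<^sup>2) * (\<eta>\<^sup>2 * \<sigma>\<^sup>2) \<le> (1 + c) * (\<eta>\<^sup>2 * \<sigma>\<^sup>2)"
      using c by (intro mult_right_mono) auto
  qed simp
  also have "\<dots> = 1/2 * (norm d)\<^sup>2 * (1 - \<eta> * \<mu> + \<alpha>\<^sup>2) + \<eta>\<^sup>2 * (1 + c) * \<sigma>\<^sup>2"
    by (simp add: field_simps)
  finally have le: "expectation ?f \<le> \<dots>" unfolding eq .
  have "(\<integral>\<^sup>+p. ennreal (?f p) \<partial>P) = ennreal (expectation ?f)"
    by (rule nn_integral_eq_integral[OF int]) simp
  then show ?thesis using le by (simp add: ennreal_leI)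
qed

theorem theorem3p6:
  fixes g :: "real ^ 'd \<Rightarrow> real ^ 'n"
    and F :: "real ^ 'n \<Rightarrow> real ^ 'n"
    and Fs :: "'x \<Rightarrow> real ^ 'n \<Rightarrow> real ^ 'n"
    and Z :: "(real ^ 'n) set"
    and zs :: "real ^ 'n"
    and P :: "'p measure" and S :: "'x measure" and M :: "'w measure"
    and \<xi> :: "'p \<Rightarrow> 'x"
    and \<xi>s :: "nat \<Rightarrow> 'w \<Rightarrow> 'x"
    and \<theta> :: "nat \<Rightarrow> 'w \<Rightarrow> real ^ 'd"
    and L \<mu> \<sigma> \<alpha> \<eta> c :: real
    and t :: nat
  assumes g_measurable: "g \<in> borel_measurable borel"
    and Z: "Z = closure (range g)" "Z = UNIV"
    and F_lipschitz: "L-lipschitz_on UNIV F"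
    and mu_pos: "\<mu> > 0"
    and F_strongly_monotone: "strongly_monotone \<mu> F"
    and z_star: "VI_solution F Z zs"
    and P: "prob_space P"
    and xi: "\<xi> \<in> measurable P S"
    and Fs_measurable: "(\<lambda>(x, z). Fs x z) \<in> borel_measurable (S \<Otimes>\<^sub>M borel)"
    and Fs_unbiased: "\<And>z. integrable P (\<lambda>p. Fs (\<xi> p) z)"
      "\<And>z. prob_space.expectation P (\<lambda>p. Fs (\<xi> p) z) = F z"
    and sigma: "\<sigma>\<^sup>2 = prob_space.expectation P (\<lambda>p. (norm (Fs (\<xi> p) zs))\<^sup>2)"
    and Fs_second_moment: "\<And>z. z \<in> Z \<Longrightarrow> integrable P (\<lambda>p. (norm (Fs (\<xi> p) z))\<^sup>2)"
      "\<And>z. z \<in> Z \<Longrightarrow> prob_space.expectation P (\<lambda>p. (norm (Fs (\<xi> p) z))\<^sup>2)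
                        \<le> 2 * L * (F z \<bullet> (z - zs)) + 2 * \<sigma>\<^sup>2"
    and alpha: "0 \<le> \<alpha>" "\<alpha> < 1"
    and Fs_lipschitz: "AE p in P. L-lipschitz_on UNIV (Fs (\<xi> p))"
    and c: "c \<ge> 2 * (1 + \<alpha>\<^sup>2)"
    and eta: "0 < \<eta>" "\<eta> \<le> 1 / (2 * (1 + c) * L)"
    and M: "prob_space M"
    and theta: "\<And>t. \<theta> t \<in> borel_measurable M"
    and samples_indep: "prob_space.indep_vars M (\<lambda>_. S) \<xi>s UNIV"
    and samples_distr: "\<And>t. distr M S (\<xi>s t) = distr P S \<xi>"
    and samples_history: "\<And>t. prob_space.indep_set M
          {\<xi>s t -` A \<inter> space M | A. A \<in> sets S} (sets (history M S \<theta> \<xi>s t t))"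
    and descent: "expected_descent \<alpha> \<eta> M S g Fs \<theta> \<xi>s"
  shows "(\<integral>\<^sup>+\<omega>. ennreal (1/2 * (norm (g (\<theta> (Suc t) \<omega>) - zs))\<^sup>2) \<partial>M)
       \<le> (\<integral>\<^sup>+\<omega>. ennreal (1/2 * (norm (g (\<theta> t \<omega>) - zs))\<^sup>2) \<partial>M) * ennreal (1 - \<eta> * \<mu> + \<alpha>\<^sup>2)
         + ennreal (\<eta>\<^sup>2 * (1 + c) * \<sigma>\<^sup>2)"
proof -
  interpret P: prob_space P by fact
  interpret M: prob_space M by fact
  have dense: "closure (range g) = UNIV" using Z by simp
  note excess = excess_loss_eq_surrogate_loss[OF dense]
  have Fzs: "F zs = 0" using z_star Z by (intro VI_solution_UNIV_zero) simp
  have "L \<ge> 0" using F_lipschitz by (rule lipschitz_on_nonneg)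
  \<comment> \<open>Division by zero yields 0, so \<open>L = 0\<close> would force \<eta> \<le>
    0.\<close>
  moreover have "L \<noteq> 0" using eta by auto
  ultimately have L: "L > 0" by simp
  have \<xi>s[measurable]: "\<xi>s s \<in> measurable M S" for s
    using samples_indep unfolding M.indep_vars_def by auto
  note [measurable] = g_measurable theta xi
  have Fs_meas[measurable]: "(\<lambda>x. Fs (a x) (b x)) \<in> borel_measurable N"
    if "a \<in> measurable N S" "b \<in> borel_measurable N" for a b and N :: "'z measure"
    using measurable_compose[OF measurable_Pair[OF that] Fs_measurable] by simp

  define z where "z s \<omega> = g (\<theta> s \<omega>)" for s \<omega>
  define G where "G \<omega> = Fs (\<xi>s t \<omega>) (z t \<omega>)" for \<omega>
  define u where "u \<omega> = z t \<omega> - zs - \<eta> *\<^sub>R G \<omega>" for \<omega>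
  define e where "e \<omega> = z (Suc t) \<omega> - (z t \<omega> - \<eta> *\<^sub>R G \<omega>)" for \<omega>
  have [measurable]: "z s \<in> borel_measurable M" for s unfolding z_def by measurable
  have [measurable]: "G \<in> borel_measurable M" unfolding G_def by measurable
  have [measurable]: "u \<in> borel_measurable M" "e \<in> borel_measurable M"
    unfolding u_def e_def by measurable

  let ?H = "history M S \<theta> \<xi>s t (Suc t)"
  interpret H: finite_measure_subalgebra M ?H
    by unfold_locales (rule subalgebra_history[OF theta \<xi>s])
  \<comment> \<open>At the current parameter \<open>z t\<close> cancels from the surrogate loss,
    which leaves \<open>1/2 * \<eta>\<^sup>2 * (norm (G \<omega>))\<^sup>2\<close> on the
    right.\<close>
  have "AE \<omega> in M. nn_cond_exp M ?H (\<lambda>\<omega>. ennreal (1/2 * (norm (e \<omega>))\<^sup>2)) \<omega>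
      \<le> ennreal (\<alpha>\<^sup>2 * (1/2 * \<eta>\<^sup>2 * (norm (G \<omega>))\<^sup>2))"
    using descent[unfolded expected_descent_def excess surrogate_loss_def, rule_format, of t]
    by (simp add: e_def G_def z_def power_mult_distrib)
  then have "(\<integral>\<^sup>+\<omega>. nn_cond_exp M ?H (\<lambda>\<omega>. ennreal (1/2 * (norm (e \<omega>))\<^sup>2)) \<omega> \<partial>M)
      \<le> (\<integral>\<^sup>+\<omega>. ennreal (\<alpha>\<^sup>2 * (1/2 * \<eta>\<^sup>2 * (norm (G \<omega>))\<^sup>2)) \<partial>M)"
    by (rule nn_integral_mono_AE)
  then have e_bound: "(\<integral>\<^sup>+\<omega>. ennreal (1/2 * (norm (e \<omega>))\<^sup>2) \<partial>M)
      \<le> (\<integral>\<^sup>+\<omega>. ennreal (\<alpha>\<^sup>2 * (1/2 * \<eta>\<^sup>2 * (norm (G \<omega>))\<^sup>2)) \<partial>M)"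
    by (subst (asm) H.nn_integral_nn_cond_exp) simp_all

  \<comment> \<open>For \<open>\<alpha> = 0\<close> the Young weight \<open>1/\<alpha>\<^sup>2\<close> is unavailable, but then \<open>e\<close> vanishes almost everywhere.\<close>
  obtain k where k: "k \<ge> 0" "k * \<alpha>\<^sup>2 \<le> 1 + \<alpha>\<^sup>2" and young: "AE \<omega> in M.
      1/2 * (norm (u \<omega> + e \<omega>))\<^sup>2 \<le> (1 + \<alpha>\<^sup>2) / 2 * (norm (u \<omega>))\<^sup>2 + k * (1/2 * (norm (e \<omega>))\<^sup>2)"
  proof (cases "\<alpha> = 0")
    case True
    then have "(\<integral>\<^sup>+\<omega>. ennreal (1/2 * (norm (e \<omega>))\<^sup>2) \<partial>M) = 0" using e_bound by simp
    then have "AE \<omega> in M. e \<omega> = 0"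
      by (subst (asm) nn_integral_0_iff_AE) auto
    then show ?thesis using True by (intro that[of 0]) auto
  next
    case False
    have "1/2 * (norm (u \<omega> + e \<omega>))\<^sup>2
        \<le> (1 + \<alpha>\<^sup>2) / 2 * (norm (u \<omega>))\<^sup>2 + (1 + 1 / \<alpha>\<^sup>2) * (1/2 * (norm (e \<omega>))\<^sup>2)" for \<omega>
      using norm_add_power2_le_weighted[of "\<alpha>\<^sup>2" "u \<omega>" "e \<omega>"] False by simp
    \<comment> \<open>With this weight \<open>k * \<alpha>\<^sup>2\<close> is exactly
      \<open>1 + \<alpha>\<^sup>2\<close>, so the error term gets the same prefactor as the term in
      \<open>u\<close>.\<close>
    then show ?thesis using False by (intro that[of "1 + 1 / \<alpha>\<^sup>2"]) (auto simp: field_simps)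
  qed

  \<comment> \<open>The bound as a deterministic function of point and sample, so that the sample
    can be integrated out at a fixed point.\<close>
  define h where "h = (\<lambda>(v, x). (1 + \<alpha>\<^sup>2) / 2 *
      ((norm (v - zs - \<eta> *\<^sub>R Fs x v))\<^sup>2 + \<eta>\<^sup>2 * (norm (Fs x v))\<^sup>2))"
  have [measurable]: "h \<in> borel_measurable (borel \<Otimes>\<^sub>M S)" unfolding h_def by measurable
  have h: "h (z t \<omega>, \<xi>s t \<omega>) = (1 + \<alpha>\<^sup>2) / 2 * ((norm (u \<omega>))\<^sup>2 + \<eta>\<^sup>2 * (norm (G \<omega>))\<^sup>2)" for \<omega>
    by (simp add: h_def u_def G_def)

  have "(\<integral>\<^sup>+\<omega>. ennreal (1/2 * (norm (z (Suc t) \<omega> - zs))\<^sup>2) \<partial>M)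
      = (\<integral>\<^sup>+\<omega>. ennreal (1/2 * (norm (u \<omega> + e \<omega>))\<^sup>2) \<partial>M)"
    by (simp add: u_def e_def algebra_simps)
  also have "\<dots> \<le> (\<integral>\<^sup>+\<omega>. ennreal ((1 + \<alpha>\<^sup>2) / 2 * (norm (u \<omega>))\<^sup>2)
      + ennreal k * ennreal (1/2 * (norm (e \<omega>))\<^sup>2) \<partial>M)"
  proof (rule nn_integral_mono_AE, use young in eventually_elim)
    fix \<omega>
    assume "1/2 * (norm (u \<omega> + e \<omega>))\<^sup>2 \<le> (1 + \<alpha>\<^sup>2) / 2 * (norm (u \<omega>))\<^sup>2 + k * (1/2 * (norm (e \<omega>))\<^sup>2)"
    then show "ennreal (1/2 * (norm (u \<omega> + e \<omega>))\<^sup>2) \<le> ennreal ((1 + \<alpha>\<^sup>2) / 2 * (norm (u \<omega>))\<^sup>2)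
        + ennreal k * ennreal (1/2 * (norm (e \<omega>))\<^sup>2)"
      using k(1) by (simp add: ennreal_leI flip: ennreal_mult ennreal_plus)
  qed
  also have "\<dots> = (\<integral>\<^sup>+\<omega>. ennreal ((1 + \<alpha>\<^sup>2) / 2 * (norm (u \<omega>))\<^sup>2) \<partial>M)
      + ennreal k * (\<integral>\<^sup>+\<omega>. ennreal (1/2 * (norm (e \<omega>))\<^sup>2) \<partial>M)"
    by (subst nn_integral_add) (simp_all add: nn_integral_cmult)
  also have "\<dots> \<le> (\<integral>\<^sup>+\<omega>. ennreal ((1 + \<alpha>\<^sup>2) / 2 * (norm (u \<omega>))\<^sup>2) \<partial>M)
      + ennreal k * (\<integral>\<^sup>+\<omega>. ennreal (\<alpha>\<^sup>2 * (1/2 * \<eta>\<^sup>2 * (norm (G \<omega>))\<^sup>2)) \<partial>M)"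
    by (intro add_left_mono mult_left_mono e_bound) simp
  also have "\<dots> = (\<integral>\<^sup>+\<omega>. ennreal ((1 + \<alpha>\<^sup>2) / 2 * (norm (u \<omega>))\<^sup>2)
      + ennreal k * ennreal (\<alpha>\<^sup>2 * (1/2 * \<eta>\<^sup>2 * (norm (G \<omega>))\<^sup>2)) \<partial>M)"
    by (subst nn_integral_add) (simp_all add: nn_integral_cmult)
  also have "\<dots> \<le> (\<integral>\<^sup>+\<omega>. ennreal (h (z t \<omega>, \<xi>s t \<omega>)) \<partial>M)"
  proof (rule nn_integral_mono)
    fix \<omega>
    have "(k * \<alpha>\<^sup>2) * (1/2 * \<eta>\<^sup>2 * (norm (G \<omega>))\<^sup>2) \<le> (1 + \<alpha>\<^sup>2) * (1/2 * \<eta>\<^sup>2 * (norm (G \<omega>))\<^sup>2)"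
      by (intro mult_right_mono k) simp
    then have "(1 + \<alpha>\<^sup>2) / 2 * (norm (u \<omega>))\<^sup>2 + k * (\<alpha>\<^sup>2 * (1/2 * \<eta>\<^sup>2 * (norm (G \<omega>))\<^sup>2))
        \<le> h (z t \<omega>, \<xi>s t \<omega>)"
      unfolding h by (simp add: algebra_simps)
    then show "ennreal ((1 + \<alpha>\<^sup>2) / 2 * (norm (u \<omega>))\<^sup>2)
        + ennreal k * ennreal (\<alpha>\<^sup>2 * (1/2 * \<eta>\<^sup>2 * (norm (G \<omega>))\<^sup>2)) \<le> ennreal (h (z t \<omega>, \<xi>s t \<omega>))"
      using k(1) by (simp add: ennreal_leI flip: ennreal_mult ennreal_plus)
  qed
  also have "\<dots> = (\<integral>\<^sup>+\<omega>. (\<integral>\<^sup>+x. ennreal (h (z t \<omega>, x)) \<partial>distr M S (\<xi>s t)) \<partial>M)"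
  proof (rule M.nn_integral_indep_set[where h = "\<lambda>p. ennreal (h p)"])
    \<comment> \<open>The history here stops before the sample \<open>\<xi>s t\<close> but includes
      \<open>\<theta> t\<close>; thus \<open>z t\<close> inherits the independence from
      \<open>\<xi>s t\<close>.\<close>
    have "z t \<in> borel_measurable (history M S \<theta> \<xi>s t t)"
      unfolding z_def by (rule measurable_compose[OF measurable_history g_measurable]) simp
    then have "{z t -` B \<inter> space M | B. B \<in> sets borel} \<subseteq> sets (history M S \<theta> \<xi>s t t)"
      by (auto simp: measurable_def space_history)
    then show "M.indep_set {z t -` B \<inter> space M | B. B \<in> sets borel}
        {\<xi>s t -` A \<inter> space M | A. A \<in> sets S}"
      using samples_history[of t] unfolding M.indep_sets2_eq
      by (metis (no_types, lifting) Int_commute mult.commute subset_iff)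
  qed simp_all
  also have "\<dots> \<le> (\<integral>\<^sup>+\<omega>. ennreal (1/2 * (norm (z t \<omega> - zs))\<^sup>2) * ennreal (1 - \<eta> * \<mu> + \<alpha>\<^sup>2)
      + ennreal (\<eta>\<^sup>2 * (1 + c) * \<sigma>\<^sup>2) \<partial>M)"
  proof (rule nn_integral_mono)
    fix \<omega>
    define v where "v = z t \<omega>"
    have "c \<ge> 0" by (rule order_trans[OF _ c]) simp
    then have noise: "\<eta>\<^sup>2 * (1 + c) * \<sigma>\<^sup>2 \<ge> 0" by simp
    have "(\<integral>\<^sup>+x. ennreal (h (v, x)) \<partial>distr M S (\<xi>s t)) = (\<integral>\<^sup>+p. ennreal (h (v, \<xi> p)) \<partial>P)"
      unfolding samples_distr by (rule nn_integral_distr) simp_all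
    also have "\<dots> \<le> ennreal (1/2 * (norm (v - zs))\<^sup>2 * (1 - \<eta> * \<mu> + \<alpha>\<^sup>2) + \<eta>\<^sup>2 * (1 + c) * \<sigma>\<^sup>2)"
      unfolding h_def prod.case
    proof (rule expected_step_bound[OF P Fs_unbiased(1) Fs_second_moment(1)])
      \<comment> \<open>Strong monotonicity between \<open>v\<close> and \<open>zs\<close>, where
        \<open>F zs = 0\<close>.\<close>
      show "\<mu> * (norm (v - zs))\<^sup>2 \<le> P.expectation (\<lambda>p. Fs (\<xi> p) v) \<bullet> (v - zs)"
        using F_strongly_monotone Fzs unfolding strongly_monotone_def Fs_unbiased(2)
        by (metis diff_zero)
    qed (use Fs_second_moment(2)[of v] Z L mu_pos eta c in \<open>simp_all add: Fs_unbiased(2)\<close>)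
    \<comment> \<open>The sign of 1 - \<eta> \<mu> + \<alpha>^2 is left open: if the first summand
      is negative, \<open>ennreal\<close> truncates it to 0 and the noise term alone dominates. The
      factorization that follows needs only the squared norm to be nonnegative.\<close>
    also have "\<dots> \<le> ennreal (1/2 * (norm (v - zs))\<^sup>2 * (1 - \<eta> * \<mu> + \<alpha>\<^sup>2)) + ennreal (\<eta>\<^sup>2 * (1 + c) * \<sigma>\<^sup>2)"
      using noise unfolding ennreal_plus_if by (simp only: if_True) (simp add: ennreal_leI)
    also have "ennreal (1/2 * (norm (v - zs))\<^sup>2 * (1 - \<eta> * \<mu> + \<alpha>\<^sup>2))
        = ennreal (1/2 * (norm (v - zs))\<^sup>2) * ennreal (1 - \<eta> * \<mu> + \<alpha>\<^sup>2)"
      by (rule ennreal_mult') simp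
    finally show "(\<integral>\<^sup>+x. ennreal (h (z t \<omega>, x)) \<partial>distr M S (\<xi>s t))
        \<le> ennreal (1/2 * (norm (z t \<omega> - zs))\<^sup>2) * ennreal (1 - \<eta> * \<mu> + \<alpha>\<^sup>2)
          + ennreal (\<eta>\<^sup>2 * (1 + c) * \<sigma>\<^sup>2)"
      unfolding v_def .
  qed
  also have "\<dots> = (\<integral>\<^sup>+\<omega>. ennreal (1/2 * (norm (z t \<omega> - zs))\<^sup>2) \<partial>M) * ennreal (1 - \<eta> * \<mu> + \<alpha>\<^sup>2)
      + ennreal (\<eta>\<^sup>2 * (1 + c) * \<sigma>\<^sup>2)"
    by (subst nn_integral_add) (simp_all add: nn_integral_multc M.emeasure_space_1)
  finally show ?thesis unfolding z_def .
qed

end
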